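(* Let $\triangle ABC$ be a triangle in the Euclidean plane that is not right-angled, let $\mathcal{C}$ be its circumcircle and $\mathcal{E}$ its Euler circle. The tangents to $\mathcal{C}$ at $A,B,C$ determine a triangle $\triangle A'B'C'$; let $\mathcal{E}'$ be the circumcircle of $\triangle A'B'C'$. Then: (1) $(\mathcal{E}',\mathcal{C})$ is a poristic pair of circles (for $n=3$); (2) a triangle $\triangle A_1B_1C_1$ has circumcircle $\mathcal{C}$ and Euler circle $\mathcal{E}$ if and only if it is an in-touch triangle with respect to $(\mathcal{E}',\mathcal{C})$.
   Context: The Euler circle (nine-point circle) of a triangle is the circle through the midpoints of its three sides. An ordered pair of circles $(\mathcal{C}_1,\mathcal{C}_2)$ is a poristic pair (for $n=3$) if there exists a (non-degenerate) triangle whose vertices lie on $\mathcal{C}_1$ and whose three side lines are tangent to $\mathcal{C}_2$ (the circles may intersect). For such a triangle, the triangle formed by the three tangency points of its side lines with $\mathcal{C}_2$ is called an in-touch triangle with respect to $(\mathcal{C}_1,\mathcal{C}_2)$. The triangle $\triangle A'B'C'$ determined by the tangents is labelled so that $A'$ is the intersection of the tangents at $B$ and $C$, $B'$ of those at $A$ and $C$, and $C'$ of those at $A$ and $B$. *)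

theory Defs
  imports "HOL-Analysis.Analysis"
begin

type_synonym point = "real ^ 2"

definition is_triangle :: "point \<Rightarrow> point \<Rightarrow> point \<Rightarrow> bool" where
  "is_triangle A B C \<longleftrightarrow> \<not> collinear {A, B, C}"

definition right_angled :: "point \<Rightarrow> point \<Rightarrow> point \<Rightarrow> bool" where
  "right_angled A B C \<longleftrightarrow>
     orthogonal (B - A) (C - A) \<or> orthogonal (A - B) (C - B) \<or> orthogonal (A - C) (B - C)"

definition is_line :: "point set \<Rightarrow> bool" where
  "is_line l \<longleftrightarrow> affine l \<and> aff_dim l = 1"

definition is_circle :: "point set \<Rightarrow> bool" where
  "is_circle S \<longleftrightarrow> (\<exists>c r. r > 0 \<and> S = sphere c r)"

text \<open>The description is proper exactly when the three points are not collinear.\<close>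

definition circumcircle :: "point \<Rightarrow> point \<Rightarrow> point \<Rightarrow> point set" where
  "circumcircle A B C = (THE S. is_circle S \<and> A \<in> S \<and> B \<in> S \<and> C \<in> S)"

definition euler_circle :: "point \<Rightarrow> point \<Rightarrow> point \<Rightarrow> point set" where
  "euler_circle A B C = circumcircle (midpoint B C) (midpoint C A) (midpoint A B)"

definition tangent_at :: "point set \<Rightarrow> point set \<Rightarrow> point \<Rightarrow> bool" where
  "tangent_at l S P \<longleftrightarrow> is_line l \<and> l \<inter> S = {P}"

definition tangent_line :: "point set \<Rightarrow> point \<Rightarrow> point set" where
  "tangent_line S P = (THE l. tangent_at l S P)"

definition side_line :: "point \<Rightarrow> point \<Rightarrow> point set" where
  "side_line P Q = affine hull {P, Q}"

text \<open>The side lines, not only the sides, are required to be tangent, so \<open>S\<close> may be the incircle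
  or an excircle of \<open>PQR\<close>, and the two circles may intersect.\<close>

definition poristic_triangle ::
    "point set \<Rightarrow> point set \<Rightarrow> point \<Rightarrow> point \<Rightarrow> point \<Rightarrow> bool" where
  "poristic_triangle K S P Q R \<longleftrightarrow>
     is_triangle P Q R \<and> P \<in> K \<and> Q \<in> K \<and> R \<in> K \<and>
     (\<exists>T. tangent_at (side_line Q R) S T) \<and>
     (\<exists>T. tangent_at (side_line R P) S T) \<and>
     (\<exists>T. tangent_at (side_line P Q) S T)"

definition poristic_pair :: "point set \<Rightarrow> point set \<Rightarrow> bool" where
  "poristic_pair K S \<longleftrightarrow>
     is_circle K \<and> is_circle S \<and> (\<exists>P Q R. poristic_triangle K S P Q R)"

definition in_touch_triangle ::
    "point set \<Rightarrow> point set \<Rightarrow> point \<Rightarrow> point \<Rightarrow> point \<Rightarrow> bool" where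
  "in_touch_triangle K S X Y Z \<longleftrightarrow>
     (\<exists>P Q R. poristic_triangle K S P Q R \<and>
        tangent_at (side_line Q R) S X \<and>
        tangent_at (side_line R P) S Y \<and>
        tangent_at (side_line P Q) S Z)"

end

theory Submission
  imports Defs
begin

text \<open>Inversion in the circle \<open>\<C>\<close> exchanges the midpoint of a chord other than a diameter
  with the intersection of the tangents at its endpoints. Hence it carries the vertices of the
  tangential triangle of any triangle inscribed in \<open>\<C>\<close> to the midpoints of the sides. As
  \<open>ABC\<close> is not right-angled, \<open>\<E>\<close> does not pass through the centre of \<open>\<C>\<close>, so its inverse
  is a circle, which must be \<open>\<E>'\<close>; a triangle inscribed in \<open>\<C>\<close> has its midpoints on \<open>\<E>\<close>
  if and only if its tangential triangle is inscribed in \<open>\<E>'\<close>.\<close>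

section \<open>Determinants and perpendiculars in the plane\<close>

lemma collinear_0_iff_det:
  fixes x y :: point
  shows "collinear {0, x, y} \<longleftrightarrow> x $ 1 * y $ 2 = x $ 2 * y $ 1"
proof
  assume "collinear {0, x, y}"
  then show "x $ 1 * y $ 2 = x $ 2 * y $ 1"
    unfolding collinear_lemma by auto
next
  assume D: "x $ 1 * y $ 2 = x $ 2 * y $ 1"
  show "collinear {0, x, y}"
  proof (cases "x = 0")
    case False
    then consider "x $ 1 \<noteq> 0" | "x $ 2 \<noteq> 0"
      by (auto simp: vec_eq_iff forall_2)
    then have "\<exists>c. y = c *\<^sub>R x"
    proof cases
      case 1
      then have "y = (y $ 1 / x $ 1) *\<^sub>R x"
        using D by (simp add: vec_eq_iff forall_2 field_simps)
      then show ?thesis ..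
    next
      case 2
      then have "y = (y $ 2 / x $ 2) *\<^sub>R x"
        using D by (simp add: vec_eq_iff forall_2 field_simps)
      then show ?thesis ..
    qed
    then show ?thesis
      unfolding collinear_lemma by auto
  qed (simp add: collinear_lemma)
qed

lemma is_triangle_iff_det:
  "is_triangle A B C \<longleftrightarrow> (B - A) $ 1 * (C - A) $ 2 \<noteq> (B - A) $ 2 * (C - A) $ 1"
proof -
  have "collinear {A, B, C} \<longleftrightarrow> collinear {B, A, C}"
    by (simp add: insert_commute)
  then show ?thesis
    using collinear_3 [of B A C] collinear_0_iff_det [of "B - A" "C - A"]
    unfolding is_triangle_def by simp
qed

text \<open>In the plane the orthogonal complement of a nonzero vector is one-dimensional, so
  \<open>v\<close> spans it.\<close>

lemma orthogonal_parallel: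
  fixes u v w :: point
  assumes "u \<noteq> 0" "v \<noteq> 0" "u \<bullet> v = 0" "u \<bullet> w = 0"
  obtains t where "w = t *\<^sub>R v"
proof -
  have u: "u $ 1 \<noteq> 0 \<or> u $ 2 \<noteq> 0"
    using \<open>u \<noteq> 0\<close> by (auto simp: vec_eq_iff forall_2)
  have e: "u $ 1 * v $ 1 = - (u $ 2 * v $ 2)" "u $ 1 * w $ 1 = - (u $ 2 * w $ 2)"
    using assms(3,4) by (auto simp: inner_vec_def sum_2)
  \<comment> \<open>Both coordinates of \<open>u\<close>, multiplied by the determinant of
    \<open>v\<close> and \<open>w\<close>, vanish; as one of them is nonzero, the determinant is
    zero.\<close>
  have "u $ 1 * (v $ 1 * w $ 2 - v $ 2 * w $ 1) = 0" "u $ 2 * (v $ 1 * w $ 2 - v $ 2 * w $ 1) = 0"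
    using e by algebra+
  then have "collinear {0, v, w}"
    using u unfolding collinear_0_iff_det by auto
  then show ?thesis
    using \<open>v \<noteq> 0\<close> that unfolding collinear_lemma by (metis scale_zero_left)
qed

section \<open>Existence and uniqueness of the circumcircle\<close>

lemma dist_eq_iff_inner:
  fixes O' P Q :: "'a::real_inner"
  shows "dist O' P = dist O' Q \<longleftrightarrow> 2 * ((O' - P) \<bullet> (Q - P)) = (Q - P) \<bullet> (Q - P)"
proof -
  have "dist O' P = dist O' Q \<longleftrightarrow> (O' - P) \<bullet> (O' - P) = (O' - Q) \<bullet> (O' - Q)"
    by (simp add: dist_norm norm_eq)
  then show ?thesis
    by (auto simp: algebra_simps inner_commute)
qed

text \<open>By \<open>dist_eq_iff_inner\<close> the perpendicular bisector conditions are linear in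
  the centre, and the determinant of the system is nonzero for a proper triangle.\<close>

lemma circumcentre_exists:
  assumes "is_triangle A B C"
  obtains O' r where "r > 0" "{A, B, C} \<subseteq> sphere O' r"
proof -
  define u v where "u = B - A" and "v = C - A"
  define D where "D = u $ 1 * v $ 2 - u $ 2 * v $ 1"
  have D: "D \<noteq> 0"
    using assms by (simp add: is_triangle_iff_det D_def u_def v_def)
  \<comment> \<open>Cramer's rule for \<open>2 * (w \<bullet> u) = u \<bullet> u\<close> and
    \<open>2 * (w \<bullet> v) = v \<bullet> v\<close>, with \<open>A\<close> as origin.\<close>
  define w :: point where "w = vector
    [((u \<bullet> u) * v $ 2 - (v \<bullet> v) * u $ 2) / (2 * D), ((v \<bullet> v) * u $ 1 - (u \<bullet> u) * v $ 1) / (2 * D)]"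
  have w1: "2 * D * w $ 1 = (u \<bullet> u) * v $ 2 - (v \<bullet> v) * u $ 2"
   and w2: "2 * D * w $ 2 = (v \<bullet> v) * u $ 1 - (u \<bullet> u) * v $ 1"
    using D by (simp_all add: w_def)
  have "D * (2 * (w \<bullet> u)) = (2 * D * w $ 1) * u $ 1 + (2 * D * w $ 2) * u $ 2"
       "D * (2 * (w \<bullet> v)) = (2 * D * w $ 1) * v $ 1 + (2 * D * w $ 2) * v $ 2"
    by (simp_all add: inner_vec_def sum_2 algebra_simps)
  then have "D * (2 * (w \<bullet> u)) = D * (u \<bullet> u)" "D * (2 * (w \<bullet> v)) = D * (v \<bullet> v)"
    unfolding w1 w2 by (simp_all add: D_def algebra_simps)
  then have "2 * (w \<bullet> u) = u \<bullet> u" "2 * (w \<bullet> v) = v \<bullet> v"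
    using D by simp_all
  then have "dist (A + w) A = dist (A + w) B" "dist (A + w) A = dist (A + w) C"
    unfolding dist_eq_iff_inner by (simp_all add: u_def v_def)
  moreover have "A + w \<noteq> A"
  proof
    assume "A + w = A"
    with calculation have "A = B" by simp
    with assms show False by (simp add: is_triangle_iff_det)
  qed
  ultimately show ?thesis
    by (intro that[of "dist (A + w) A" "A + w"]) auto
qed

text \<open>This gives access to the definite description. The difference of two candidate centres
  is orthogonal to two independent sides, hence zero.\<close>

lemma circumcircle_eqI:
  assumes T: "is_triangle A B C" and r: "r > 0" and S: "{A, B, C} \<subseteq> sphere O' r"
  shows "circumcircle A B C = sphere O' r"
  unfolding circumcircle_def
proof (rule the_equality)
  show "is_circle (sphere O' r) \<and> A \<in> sphere O' r \<and> B \<in> sphere O' r \<and> C \<in> sphere O' r"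
    using r S by (auto simp: is_circle_def)
next
  fix K assume "is_circle K \<and> A \<in> K \<and> B \<in> K \<and> C \<in> K"
  then obtain N s where K: "K = sphere N s" and N: "dist N A = s" "dist N B = s" "dist N C = s"
    by (auto simp: is_circle_def)
  have eqs: "dist N A = dist N B" "dist N A = dist N C" "dist O' A = dist O' B" "dist O' A = dist O' C"
    using N S by auto
  define w where "w = N - O'"
  have "2 * ((N - A) \<bullet> (B - A)) = 2 * ((O' - A) \<bullet> (B - A))"
       "2 * ((N - A) \<bullet> (C - A)) = 2 * ((O' - A) \<bullet> (C - A))"
    using eqs unfolding dist_eq_iff_inner by simp_all
  then have w: "w \<bullet> (B - A) = 0" "w \<bullet> (C - A) = 0"
    by (auto simp: w_def inner_diff_left)
  have "w = 0"
  proof (rule ccontr)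
    assume "w \<noteq> 0"
    have "B - A \<noteq> 0"
      using T by (auto simp: is_triangle_iff_det)
    with \<open>w \<noteq> 0\<close> w obtain t where "C - A = t *\<^sub>R (B - A)"
      by (metis orthogonal_parallel)
    with T show False by (simp add: is_triangle_iff_det)
  qed
  then have "N = O'" by (simp add: w_def)
  with K N S show "K = sphere O' r" by auto
qed

text \<open>A line meets a circle in at most two points: along the line through \<open>R\<close> and
  \<open>P\<close>, being at the same distance from \<open>N\<close> as \<open>R\<close> reads
  \<open>t = t * t\<close>, and the roots 0 and 1 are \<open>R\<close> and \<open>P\<close>
  themselves.\<close>

lemma is_triangle_of_circle:
  assumes "P \<noteq> Q" "Q \<noteq> R" "P \<noteq> R" "{P, Q, R} \<subseteq> sphere N s"
  shows "is_triangle P Q R"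
  unfolding is_triangle_def
proof
  assume "collinear {P, Q, R}"
  then obtain t where t: "Q = t *\<^sub>R P + (1 - t) *\<^sub>R R"
    using \<open>P \<noteq> R\<close> unfolding collinear_3_expand by auto
  have "dist N P = dist N Q" "dist N P = dist N R"
    using assms by auto
  then have "dist N R = dist N P" "dist N R = dist N Q" by simp_all
  moreover have "Q - R = t *\<^sub>R (P - R)"
    using t by (auto simp: algebra_simps)
  ultimately have "2 * ((N - R) \<bullet> (P - R)) = (P - R) \<bullet> (P - R)"
    and "2 * ((N - R) \<bullet> (t *\<^sub>R (P - R))) = (t *\<^sub>R (P - R)) \<bullet> (t *\<^sub>R (P - R))"
    unfolding dist_eq_iff_inner by metis+
  then have "t * ((P - R) \<bullet> (P - R)) = t * (t * ((P - R) \<bullet> (P - R)))"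
    unfolding inner_scaleR_left inner_scaleR_right by (metis mult.left_commute)
  then have "t = 0 \<or> t = 1"
    using \<open>P \<noteq> R\<close> by simp
  then show False
    using t assms(1-3) by auto
qed

lemma midpoint_triangle:
  assumes "is_triangle A B C"
  shows "is_triangle (midpoint B C) (midpoint C A) (midpoint A B)"
  using assms unfolding is_triangle_iff_det midpoint_def by (auto simp: algebra_simps)

section \<open>Lines, polars and tangents\<close>

abbreviation polar :: "point \<Rightarrow> real \<Rightarrow> point \<Rightarrow> point set" where
  "polar O' r P \<equiv> {x. (P - O') \<bullet> x = (P - O') \<bullet> O' + r\<^sup>2}"

text \<open>The polar \<open>(P - O') \<bullet> (x - O') = r\<^sup>2\<close> is expanded into the
  form of a hyperplane, which has dimension 1 in the plane when its normal vector is
  nonzero.\<close>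

lemma is_line_polar:
  assumes "P \<noteq> O'"
  shows "is_line (polar O' r P)"
  using assms by (simp add: is_line_def affine_hyperplane)

lemma is_line_subset_eq:
  assumes "is_line l" "is_line m" "l \<subseteq> m"
  shows "l = m"
proof -
  have "l \<noteq> {}" using assms by (auto simp: is_line_def)
  with assms show ?thesis
    unfolding is_line_def by (intro affine_dim_equal) auto
qed

lemma is_line_side_line:
  assumes "P \<noteq> Q"
  shows "is_line (side_line P Q)"
  using assms by (simp add: is_line_def side_line_def affine_affine_hull aff_dim_affine_hull aff_dim_2)

lemma is_line_imp_side_line:
  assumes "is_line l" "P \<in> l"
  obtains Q where "Q \<noteq> P" "l = side_line P Q"
proof -
  have "l \<noteq> {P}" using assms by (auto simp: is_line_def)
  then obtain Q where Q: "Q \<in> l" "Q \<noteq> P" using assms by auto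
  then have "side_line P Q \<subseteq> l"
    using assms unfolding side_line_def is_line_def by (intro hull_minimal) auto
  with Q assms show ?thesis
    using that [of Q] is_line_subset_eq [of "side_line P Q" l] is_line_side_line [of P Q] by simp
qed

lemma side_line_eqI:
  assumes "is_line l" "P \<in> l" "Q \<in> l" "P \<noteq> Q"
  shows "side_line P Q = l"
proof (rule is_line_subset_eq)
  show "side_line P Q \<subseteq> l"
    using assms unfolding side_line_def is_line_def by (intro hull_minimal) auto
qed (use assms is_line_side_line in auto)

lemma side_line_param: "X \<in> side_line P Q \<longleftrightarrow> (\<exists>t. X = P + t *\<^sub>R (Q - P))"
proof
  assume "X \<in> side_line P Q"
  then obtain u v where "u + v = 1" "X = u *\<^sub>R P + v *\<^sub>R Q"
    by (auto simp: side_line_def affine_hull_2)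
  moreover from this have "u = 1 - v" by simp
  ultimately have "X = P + v *\<^sub>R (Q - P)" by (simp add: algebra_simps)
  then show "\<exists>t. X = P + t *\<^sub>R (Q - P)" ..
next
  assume "\<exists>t. X = P + t *\<^sub>R (Q - P)"
  then obtain t where "X = (1 - t) *\<^sub>R P + t *\<^sub>R Q" by (auto simp: algebra_simps)
  then show "X \<in> side_line P Q"
    unfolding side_line_def affine_hull_2 by (auto intro: exI[of _ "1 - t"])
qed

lemma mem_sphere_inner:
  fixes O' P :: "'a::real_inner"
  assumes "r > 0"
  shows "P \<in> sphere O' r \<longleftrightarrow> (P - O') \<bullet> (P - O') = r\<^sup>2"
  using assms by (simp add: dist_norm norm_minus_commute flip: power2_norm_eq_inner)

text \<open>Translates tangency, defined by a single common point, into an equation: the tangent at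
  a point of the circle is its polar.\<close>

lemma tangent_at_sphere_iff:
  assumes r: "r > 0"
  shows "tangent_at l (sphere O' r) P \<longleftrightarrow> P \<in> sphere O' r \<and> l = polar O' r P"
proof
  assume "P \<in> sphere O' r \<and> l = polar O' r P"
  then have P: "P \<in> sphere O' r" and l: "l = polar O' r P" by auto
  have PP: "(P - O') \<bullet> (P - O') = r\<^sup>2"
    using P unfolding mem_sphere_inner [OF r] .
  have "P \<noteq> O'" using P r by auto
  moreover have "X = P" if "X \<in> polar O' r P" "X \<in> sphere O' r" for X
  proof -
    define x p where "x = X - O'" and "p = P - O'"
    have "x \<bullet> x = r\<^sup>2" "p \<bullet> p = r\<^sup>2"
      using that(2) PP unfolding mem_sphere_inner [OF r] x_def p_def .
    moreover have "p \<bullet> x = r\<^sup>2"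
      using that by (simp add: x_def p_def inner_diff_right)
    \<comment> \<open>Equality case of Cauchy-Schwarz: two vectors of length \<open>r\<close> with
      inner product \<open>r\<^sup>2\<close> coincide.\<close>
    ultimately have "(x - p) \<bullet> (x - p) = 0"
      by (simp add: inner_diff_left inner_diff_right inner_commute)
    then show ?thesis by (simp add: x_def p_def)
  qed
  moreover have "P \<in> polar O' r P"
    using PP by (simp add: inner_diff_right)
  ultimately have "is_line l" "l \<inter> sphere O' r = {P}"
    unfolding l using P is_line_polar by blast+
  then show "tangent_at l (sphere O' r) P"
    unfolding tangent_at_def ..
next
  assume T: "tangent_at l (sphere O' r) P"
  then have P: "P \<in> sphere O' r" and l: "is_line l" "P \<in> l"
    and uniq: "l \<inter> sphere O' r = {P}"
    unfolding tangent_at_def by blast+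
  obtain Q where Q: "Q \<noteq> P" "l = side_line P Q"
    using l is_line_imp_side_line by blast
  define p d where "p = P - O'" and "d = Q - P"
  have pp: "p \<bullet> p = r\<^sup>2"
    using P unfolding mem_sphere_inner [OF r] p_def .
  have "d \<noteq> 0" using Q by (simp add: d_def)
  \<comment> \<open>The parameter of the second intersection of the line with the circle. Tangency
    forces it to be 0, that is, \<open>d\<close> is perpendicular to the radius.\<close>
  define t where "t = - 2 * (p \<bullet> d) / (d \<bullet> d)"
  have "(p + t *\<^sub>R d) \<bullet> (p + t *\<^sub>R d) = p \<bullet> p + t * (2 * (p \<bullet> d) + t * (d \<bullet> d))"
    by (simp add: algebra_simps inner_commute)
  also have "2 * (p \<bullet> d) + t * (d \<bullet> d) = 0"
    using \<open>d \<noteq> 0\<close> by (simp add: t_def)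
  also have "p + t *\<^sub>R d = P + t *\<^sub>R d - O'"
    by (simp add: p_def)
  finally have "P + t *\<^sub>R d \<in> sphere O' r"
    using pp unfolding mem_sphere_inner [OF r] by simp
  moreover have "P + t *\<^sub>R d \<in> l"
    unfolding Q side_line_param d_def by blast
  ultimately have "P + t *\<^sub>R d = P"
    using uniq by blast
  then have "t = 0"
    using \<open>d \<noteq> 0\<close> by simp
  then have pd: "p \<bullet> d = 0" using \<open>d \<noteq> 0\<close> by (simp add: t_def)
  have "l = polar O' r P"
    unfolding Q(2)
  proof (rule side_line_eqI)
    show "is_line (polar O' r P)"
      using P r by (intro is_line_polar) auto
    show "P \<in> polar O' r P" "Q \<in> polar O' r P"
      using pp pd by (simp_all add: p_def d_def inner_diff_right)
  qed (use Q in auto)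
  with P show "P \<in> sphere O' r \<and> l = polar O' r P" by simp
qed

lemma tangent_line_sphere:
  assumes "r > 0" "P \<in> sphere O' r"
  shows "tangent_line (sphere O' r) P = polar O' r P"
  using assms by (simp add: tangent_line_def tangent_at_sphere_iff)

section \<open>Inversion and poles of chords\<close>

definition inversion :: "'a::real_inner \<Rightarrow> real \<Rightarrow> 'a \<Rightarrow> 'a" where
  "inversion O' r P = O' + (r\<^sup>2 / (norm (P - O'))\<^sup>2) *\<^sub>R (P - O')"

text \<open>Away from the centre the two scaling factors are reciprocal. The centre is fixed because
  division by zero yields 0, so the law has no exception.\<close>

lemma inversion_inversion:
  assumes "r > 0"
  shows "inversion O' r (inversion O' r P) = P"
proof (cases "P = O'")
  case False
  define m where "m = (norm (P - O'))\<^sup>2"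
  have m: "m > 0" using False by (simp add: m_def)
  have Q: "inversion O' r P - O' = (r\<^sup>2 / m) *\<^sub>R (P - O')"
    by (simp add: inversion_def m_def)
  have "(norm (inversion O' r P - O'))\<^sup>2 = (r\<^sup>2 / m)\<^sup>2 * m"
    unfolding Q norm_scaleR power_mult_distrib m_def [symmetric] using m by simp
  then have "r\<^sup>2 / (norm (inversion O' r P - O'))\<^sup>2 * (r\<^sup>2 / m) = 1"
    using m assms by (simp add: field_simps power2_eq_square)
  then show ?thesis
    unfolding inversion_def [of _ _ "inversion O' r P"] Q by simp
qed (simp add: inversion_def)

text \<open>For \<open>P = O'\<close> the junk value \<open>inversion O' r O' = O'\<close> is harmless, since neither circle
  passes through \<open>O'\<close>.\<close>

lemma inversion_sphere:
  fixes O' N :: "'a::real_inner"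
  assumes r: "r > 0" and s: "s > 0" and out: "O' \<notin> sphere N s"
  obtains N' s' where "s' > 0" "\<And>P. inversion O' r P \<in> sphere N s \<longleftrightarrow> P \<in> sphere N' s'"
proof -
  define n where "n = N - O'"
  \<comment> \<open>The power of \<open>O'\<close> with respect to \<open>sphere N s\<close>; it is
    nonzero because \<open>O'\<close> is off that sphere.\<close>
  define k where "k = n \<bullet> n - s\<^sup>2"
  have k: "k \<noteq> 0"
  proof
    assume "k = 0"
    then have "norm n = s" using s by (simp add: k_def norm_eq_sqrt_inner)
    with out show False by (simp add: n_def dist_norm)
  qed
  \<comment> \<open>The image sphere is also the image of \<open>sphere N s\<close> under the
    homothety with centre \<open>O'\<close> and ratio \<open>r\<^sup>2 / k\<close>; as the ratio may
    be negative, the radius takes its absolute value.\<close>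
  define N' where "N' = O' + (r\<^sup>2 / k) *\<^sub>R n"
  define s' where "s' = r\<^sup>2 * s / \<bar>k\<bar>"
  have s': "s' > 0" using r s k by (simp add: s'_def)
  have "inversion O' r P \<in> sphere N s \<longleftrightarrow> P \<in> sphere N' s'" for P
  proof (cases "P = O'")
    case True
    have "(r\<^sup>2 / k) *\<^sub>R n \<bullet> (r\<^sup>2 / k) *\<^sub>R n \<noteq> s'\<^sup>2"
    proof
      assume "(r\<^sup>2 / k) *\<^sub>R n \<bullet> (r\<^sup>2 / k) *\<^sub>R n = s'\<^sup>2"
      then have "(r\<^sup>2 / k)\<^sup>2 * (n \<bullet> n) = (r\<^sup>2 / k)\<^sup>2 * s\<^sup>2"
        by (simp add: s'_def power_divide power_mult_distrib power2_eq_square)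
      then show False using r k by (simp add: k_def)
    qed
    then have "P \<notin> sphere N' s'"
      unfolding mem_sphere_inner [OF s'] by (simp add: True N'_def)
    then show ?thesis using out True by (simp add: inversion_def)
  next
    case False
    define p where "p = P - O'"
    define m where "m = p \<bullet> p"
    have m: "m \<noteq> 0" using False by (simp add: m_def p_def)
    define c where "c = r\<^sup>2 / m"
    have cm: "c * m = r\<^sup>2" using m by (simp add: c_def)
    have "inversion O' r P - N = c *\<^sub>R p - n"
      by (simp add: inversion_def p_def n_def c_def m_def power2_norm_eq_inner)
    then have "inversion O' r P \<in> sphere N s \<longleftrightarrow> (c *\<^sub>R p - n) \<bullet> (c *\<^sub>R p - n) = s\<^sup>2"
      unfolding mem_sphere_inner [OF s] by simp
    also have "\<dots> \<longleftrightarrow> c * (c * m) - 2 * c * (p \<bullet> n) + k = 0"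
      by (auto simp: k_def m_def algebra_simps inner_commute)
    \<comment> \<open>Multiplying by \<open>m\<close> clears the denominator of \<open>c\<close>,
      leaving a quadratic in \<open>p\<close> with leading coefficient \<open>k\<close>. Completing
      the square then produces the new sphere.\<close>
    also have "\<dots> \<longleftrightarrow> m * (c * (c * m) - 2 * c * (p \<bullet> n) + k) = 0"
      using m by simp
    also have "m * (c * (c * m) - 2 * c * (p \<bullet> n) + k) = (r\<^sup>2)\<^sup>2 - 2 * r\<^sup>2 * (p \<bullet> n) + k * m"
      unfolding cm [symmetric] by (simp add: algebra_simps power2_eq_square)
    also have "\<dots> = 0 \<longleftrightarrow> k * ((p - (r\<^sup>2 / k) *\<^sub>R n) \<bullet> (p - (r\<^sup>2 / k) *\<^sub>R n) - s'\<^sup>2) = 0"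
    proof -
      define q where "q = r\<^sup>2 / k"
      have kq: "k * q = r\<^sup>2" using k by (simp add: q_def)
      have "s'\<^sup>2 = q\<^sup>2 * s\<^sup>2"
        by (simp add: s'_def q_def power_divide power_mult_distrib)
      then have "(p - q *\<^sub>R n) \<bullet> (p - q *\<^sub>R n) - s'\<^sup>2 = m - 2 * q * (p \<bullet> n) + q * (k * q)"
        by (simp add: m_def k_def algebra_simps inner_commute power2_eq_square)
      then have "k * ((p - q *\<^sub>R n) \<bullet> (p - q *\<^sub>R n) - s'\<^sup>2)
          = k * (m - 2 * q * (p \<bullet> n) + q * (k * q))"
        by simp
      also have "\<dots> = k * m - 2 * (k * q) * (p \<bullet> n) + (k * q) * (k * q)"
        by (simp only: distrib_left right_diff_distrib mult.assoc mult.left_commute)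
      also have "\<dots> = (r\<^sup>2)\<^sup>2 - 2 * r\<^sup>2 * (p \<bullet> n) + k * m"
        unfolding kq by (simp add: power2_eq_square)
      finally show ?thesis
        unfolding q_def by (simp only:)
    qed
    also have "p - (r\<^sup>2 / k) *\<^sub>R n = P - N'"
      by (simp add: p_def N'_def)
    also have "k * ((P - N') \<bullet> (P - N') - s'\<^sup>2) = 0 \<longleftrightarrow> (P - N') \<bullet> (P - N') = s'\<^sup>2"
      using k by simp
    finally show ?thesis unfolding mem_sphere_inner [OF s'] .
  qed
  with s' show ?thesis by (rule that)
qed

text \<open>The vectors from \<open>O'\<close> to the midpoint and to a common point of both polars
  are each orthogonal to the chord, hence parallel, and the polar equations fix the factor. For a
  diameter the tangents are parallel and both sides are false.\<close>

lemma pole_of_chord: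
  assumes r: "r > 0" and YZ: "Y \<in> sphere O' r" "Z \<in> sphere O' r" "Y \<noteq> Z"
  shows "P \<in> polar O' r Y \<inter> polar O' r Z \<longleftrightarrow>
    midpoint Y Z \<noteq> O' \<and> P = inversion O' r (midpoint Y Z)"
proof -
  define y z p m where "y = Y - O'" and "z = Z - O'" and "p = P - O'" and "m = (1/2) *\<^sub>R (y + z)"
  have yy: "y \<bullet> y = r\<^sup>2" and zz: "z \<bullet> z = r\<^sup>2"
    using YZ(1,2) unfolding mem_sphere_inner [OF r] y_def z_def .
  have mid: "midpoint Y Z - O' = m"
    by (simp add: midpoint_def m_def y_def z_def algebra_simps flip: scaleR_2)
  have yz: "y - z \<noteq> 0" using YZ by (simp add: y_def z_def)
  have orth: "(y - z) \<bullet> m = 0"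
    using yy zz by (simp add: m_def algebra_simps inner_commute)
  have "P \<in> polar O' r Y \<inter> polar O' r Z \<longleftrightarrow> y \<bullet> p = r\<^sup>2 \<and> z \<bullet> p = r\<^sup>2"
    by (auto simp: y_def z_def p_def inner_diff_right)
  \<comment> \<open>The difference and half the sum of the two equations.\<close>
  also have "\<dots> \<longleftrightarrow> (y - z) \<bullet> p = 0 \<and> m \<bullet> p = r\<^sup>2"
    by (auto simp: m_def inner_diff_left inner_add_left)
  also have "\<dots> \<longleftrightarrow> m \<noteq> 0 \<and> p = (r\<^sup>2 / (m \<bullet> m)) *\<^sub>R m"
  proof
    assume *: "(y - z) \<bullet> p = 0 \<and> m \<bullet> p = r\<^sup>2"
    then have "m \<noteq> 0" using r by auto
    with yz orth * obtain t where t: "p = t *\<^sub>R m"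
      by (metis orthogonal_parallel)
    with * have "t * (m \<bullet> m) = r\<^sup>2" by simp
    with \<open>m \<noteq> 0\<close> have "t = r\<^sup>2 / (m \<bullet> m)" by (simp add: field_simps)
    with t \<open>m \<noteq> 0\<close> show "m \<noteq> 0 \<and> p = (r\<^sup>2 / (m \<bullet> m)) *\<^sub>R m" by simp
  qed (use orth in auto)
  also have "\<dots> \<longleftrightarrow> midpoint Y Z \<noteq> O' \<and> P = inversion O' r (midpoint Y Z)"
    unfolding inversion_def mid power2_norm_eq_inner
    using mid by (auto simp: p_def algebra_simps)
  finally show ?thesis .
qed

section \<open>The Euler circle and the circumcentre\<close>

text \<open>The centre given is the midpoint of circumcentre and orthocentre; it differs from the
  midpoint of each side by half the radius vector of the opposite vertex.\<close>

lemma euler_circle_eq: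
  assumes T: "is_triangle A B C" and r: "r > 0" and S: "{A, B, C} \<subseteq> sphere O' r"
  shows "euler_circle A B C
    = sphere (O' + (1/2) *\<^sub>R ((A - O') + (B - O') + (C - O'))) (r / 2)"
  unfolding euler_circle_def
proof (rule circumcircle_eqI [OF midpoint_triangle [OF T]])
  let ?N = "O' + (1/2) *\<^sub>R ((A - O') + (B - O') + (C - O'))"
  have "?N - midpoint B C = (1/2) *\<^sub>R (A - O')" "?N - midpoint C A = (1/2) *\<^sub>R (B - O')"
       "?N - midpoint A B = (1/2) *\<^sub>R (C - O')"
    by (simp_all add: midpoint_def vec_eq_iff field_simps)
  then show "{midpoint B C, midpoint C A, midpoint A B} \<subseteq> sphere ?N (r / 2)"
    using S by (simp add: dist_norm norm_minus_commute)
qed (use r in simp)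

text \<open>The circumcentre is the orthocentre of the medial triangle, and an orthocentre lying on
  the circumcircle forces a right angle.\<close>

lemma circumcentre_notin_euler_circle:
  assumes T: "is_triangle A B C" and R: "\<not> right_angled A B C"
    and r: "r > 0" and S: "{A, B, C} \<subseteq> sphere O' r"
  shows "O' \<notin> euler_circle A B C"
proof
  assume E: "O' \<in> euler_circle A B C"
  define a b c where "a = A - O'" and "b = B - O'" and "c = C - O'"
  have aa: "a \<bullet> a = r\<^sup>2" and bb: "b \<bullet> b = r\<^sup>2" and cc: "c \<bullet> c = r\<^sup>2"
    using S unfolding insert_subset mem_sphere_inner [OF r] a_def b_def c_def by simp_all
  \<comment> \<open>Thales: the diameter from \<open>y\<close> to \<open>- y\<close> subtends a
    right angle at \<open>x\<close>. Hence no side of the triangle is a diameter.\<close>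
  have right: "(y - x) \<bullet> (- y - x) = 0" if "x \<bullet> x = r\<^sup>2" "y \<bullet> y = r\<^sup>2" for x y :: point
    using that by (simp add: algebra_simps inner_commute)
  have sides: "B - A = b - a" "C - A = c - a" "C - B = c - b" "A - B = a - b" "A - C = a - c"
      "B - C = b - c"
    by (simp_all add: a_def b_def c_def)
  have nopp: "b \<noteq> - a" "c \<noteq> - b" "c \<noteq> - a"
    using R right [OF cc aa] right [OF aa bb] right [OF bb aa]
    unfolding right_angled_def orthogonal_def sides by metis+
  have "norm (a + b + c) = r"
    using E euler_circle_eq [OF T r S] by (simp add: a_def b_def c_def dist_norm)
  then have h: "(a + b + c) \<bullet> (a + b + c) = r\<^sup>2"
    by (simp flip: power2_norm_eq_inner)
  have ab: "a \<noteq> b"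
    using T by (auto simp: a_def b_def is_triangle_iff_det)
  \<comment> \<open>With \<open>h = a + b + c\<close> the second product is
    \<open>(h - c) \<bullet> (h + c)\<close>, which vanishes since \<open>h\<close> and
    \<open>c\<close> both have length \<open>r\<close>.\<close>
  have "(a + b) \<bullet> (a - b) = 0" "(a + b) \<bullet> (a + b + 2 *\<^sub>R c) = 0"
    using aa bb cc h by (simp_all add: algebra_simps inner_commute)
  moreover have "a + b \<noteq> 0" "a - b \<noteq> 0"
    using nopp ab by (auto simp: add_eq_0_iff)
  ultimately obtain t where "a + b + 2 *\<^sub>R c = t *\<^sub>R (a - b)"
    using orthogonal_parallel by blast
  then have c2: "2 *\<^sub>R c = (t - 1) *\<^sub>R a - (t + 1) *\<^sub>R b"
    by (simp add: algebra_simps)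
  \<comment> \<open>Comparing lengths leaves only \<open>t = 1\<close> and \<open>t = - 1\<close>,
    which make \<open>c\<close> the antipode of \<open>b\<close> or of \<open>a\<close>.\<close>
  have "4 * r\<^sup>2 = (2 *\<^sub>R c) \<bullet> (2 *\<^sub>R c)"
    by (simp add: cc)
  also have "\<dots> = (t - 1) * (t - 1) * (a \<bullet> a) + (t + 1) * (t + 1) * (b \<bullet> b)
      - 2 * ((t - 1) * (t + 1)) * (a \<bullet> b)"
    unfolding c2 by (simp add: inner_diff_left inner_diff_right inner_commute algebra_simps)
  finally have "((t - 1) * (t + 1)) * (2 * r\<^sup>2 - 2 * (a \<bullet> b)) = 0"
    unfolding aa bb by (simp add: algebra_simps)
  moreover have "2 * r\<^sup>2 - 2 * (a \<bullet> b) = (a - b) \<bullet> (a - b)"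
    using aa bb by (simp add: algebra_simps inner_commute)
  ultimately have "t - 1 = 0 \<or> t + 1 = 0"
    using ab by simp
  then have "t = 1 \<or> t = - 1"
    by (simp add: add_eq_0_iff2)
  then have "2 *\<^sub>R c = 2 *\<^sub>R (- b) \<or> 2 *\<^sub>R c = 2 *\<^sub>R (- a)"
    unfolding c2 by (elim disjE) simp_all
  then show False
    using nopp unfolding real_vector.scale_cancel_left by simp
qed

text \<open>Two distinct poles on the same tangent span it, so the side lines are the tangents. The
  poles are distinct because inversion is an involution and the midpoints differ; lying on a common
  circle, they are then not collinear.\<close>

lemma tangential_triangle:
  assumes r: "r > 0" and s: "s > 0" and T: "is_triangle X Y Z"
    and S: "{X, Y, Z} \<subseteq> sphere O' r"
    and out: "O' \<notin> {midpoint Y Z, midpoint Z X, midpoint X Y}"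
    and P: "P = inversion O' r (midpoint Y Z)" "Q = inversion O' r (midpoint Z X)"
      "R = inversion O' r (midpoint X Y)"
    and K: "{P, Q, R} \<subseteq> sphere N s"
  shows "is_triangle P Q R"
    and "tangent_at (side_line Q R) (sphere O' r) X"
    and "tangent_at (side_line R P) (sphere O' r) Y"
    and "tangent_at (side_line P Q) (sphere O' r) Z"
proof -
  have ne: "X \<noteq> Y" "Y \<noteq> Z" "Z \<noteq> X"
    using T by (auto simp: is_triangle_iff_det)
  have pole: "inversion O' r (midpoint V W) \<in> polar O' r V \<inter> polar O' r W"
    if "V \<in> sphere O' r" "W \<in> sphere O' r" "V \<noteq> W" "midpoint V W \<noteq> O'" for V W
    using pole_of_chord [OF r that(1-3)] that(4) by blast
  have on: "P \<in> polar O' r Y \<inter> polar O' r Z" "Q \<in> polar O' r Z \<inter> polar O' r X"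
      "R \<in> polar O' r X \<inter> polar O' r Y"
    using S out ne unfolding P by - (rule pole; blast)+
  have inv: "inversion O' r P = midpoint Y Z" "inversion O' r Q = midpoint Z X"
      "inversion O' r R = midpoint X Y"
    using r by (simp_all add: P inversion_inversion)
  have "P \<noteq> Q" "Q \<noteq> R" "R \<noteq> P"
    using inv ne by (auto simp: midpoint_def)
  then show "is_triangle P Q R"
    using K by (intro is_triangle_of_circle) auto
  have "X \<noteq> O'" "Y \<noteq> O'" "Z \<noteq> O'"
    using S r by auto
  then have "side_line Q R = polar O' r X" "side_line R P = polar O' r Y"
      "side_line P Q = polar O' r Z"
    using on \<open>P \<noteq> Q\<close> \<open>Q \<noteq> R\<close> \<open>R \<noteq> P\<close> by (intro side_line_eqI is_line_polar; blast)+
  then show "tangent_at (side_line Q R) (sphere O' r) X"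
     "tangent_at (side_line R P) (sphere O' r) Y"
     "tangent_at (side_line P Q) (sphere O' r) Z"
    using S by (simp_all add: tangent_at_sphere_iff [OF r])
qed

section \<open>Tangential triangles and the inverse of the Euler circle\<close>

theorem theorem1:
  fixes A B C :: point and \<C> \<E> :: "point set"
  assumes "is_triangle A B C"
    and "\<not> right_angled A B C"
    and "\<C> = circumcircle A B C"
    and "\<E> = euler_circle A B C"
  shows "\<exists>A' B' C' \<E>'.
           tangent_line \<C> B \<inter> tangent_line \<C> C = {A'} \<and>
           tangent_line \<C> A \<inter> tangent_line \<C> C = {B'} \<and>
           tangent_line \<C> A \<inter> tangent_line \<C> B = {C'} \<and>
           is_triangle A' B' C' \<and>
           \<E>' = circumcircle A' B' C' \<and>
           poristic_pair \<E>' \<C> \<and>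
           (\<forall>A\<^sub>1 B\<^sub>1 C\<^sub>1. is_triangle A\<^sub>1 B\<^sub>1 C\<^sub>1 \<longrightarrow>
              (circumcircle A\<^sub>1 B\<^sub>1 C\<^sub>1 = \<C> \<and> euler_circle A\<^sub>1 B\<^sub>1 C\<^sub>1 = \<E>
                 \<longleftrightarrow> in_touch_triangle \<E>' \<C> A\<^sub>1 B\<^sub>1 C\<^sub>1))"
proof -
  obtain O' r where r: "r > 0" and S: "{A, B, C} \<subseteq> sphere O' r"
    using circumcentre_exists [OF assms(1)] .
  have C: "\<C> = sphere O' r"
    using assms(1,3) r S by (simp add: circumcircle_eqI)
  obtain N s where s: "s > 0" and E: "\<E> = sphere N s"
    using euler_circle_eq [OF assms(1) r S] r assms(4) by (metis half_gt_zero)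
  have out: "O' \<notin> sphere N s"
    using circumcentre_notin_euler_circle [OF assms(1,2) r S] assms(4) E by simp
  obtain N' s' where s': "s' > 0"
    and inv: "\<And>P. inversion O' r P \<in> sphere N s \<longleftrightarrow> P \<in> sphere N' s'"
    using inversion_sphere [OF r s out] by blast
  have inv': "inversion O' r P \<in> sphere N' s' \<longleftrightarrow> P \<in> sphere N s" for P
    using inv [of "inversion O' r P"] unfolding inversion_inversion [OF r] ..
  \<comment> \<open>As \<open>euler_circle\<close> is a definite description, some circle through
    the midpoints must be exhibited before they are known to lie on it.\<close>
  have mids: "{midpoint Y Z, midpoint Z X, midpoint X Y} \<subseteq> \<E>"
    if T: "is_triangle X Y Z" and XYZ: "{X, Y, Z} \<subseteq> sphere O' r" and e: "euler_circle X Y Z = \<E>"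
    for X Y Z
  proof -
    obtain M q where "q > 0" "{midpoint Y Z, midpoint Z X, midpoint X Y} \<subseteq> sphere M q"
      using circumcentre_exists [OF midpoint_triangle [OF T]] .
    with circumcircle_eqI [OF midpoint_triangle [OF T] this] e show ?thesis
      unfolding euler_circle_def by simp
  qed
  \<comment> \<open>Serves twice: for \<open>ABC\<close> it gives the poristic pair, and for an
    arbitrary triangle one direction of the equivalence.\<close>
  have touch: "\<exists>P Q R. P = inversion O' r (midpoint Y Z) \<and> Q = inversion O' r (midpoint Z X) \<and>
      R = inversion O' r (midpoint X Y) \<and> O' \<notin> {midpoint Y Z, midpoint Z X, midpoint X Y} \<and>
      poristic_triangle (sphere N' s') \<C> P Q R \<and> tangent_at (side_line Q R) \<C> X \<and>
      tangent_at (side_line R P) \<C> Y \<and> tangent_at (side_line P Q) \<C> Z"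
    if T: "is_triangle X Y Z" and XYZ: "{X, Y, Z} \<subseteq> sphere O' r" and e: "euler_circle X Y Z = \<E>"
    for X Y Z
  proof (intro exI conjI)
    let ?P = "inversion O' r (midpoint Y Z)" and ?Q = "inversion O' r (midpoint Z X)"
      and ?R = "inversion O' r (midpoint X Y)"
    note m = mids [OF that]
    show mout: "O' \<notin> {midpoint Y Z, midpoint Z X, midpoint X Y}"
      using m out E by blast
    have K: "{?P, ?Q, ?R} \<subseteq> sphere N' s'"
      using m unfolding E insert_subset inv' by blast
    note tt = tangential_triangle [OF r s' T XYZ mout refl refl refl K]
    show "tangent_at (side_line ?Q ?R) \<C> X" "tangent_at (side_line ?R ?P) \<C> Y"
      "tangent_at (side_line ?P ?Q) \<C> Z"
      using tt by (simp_all add: C)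
    show "poristic_triangle (sphere N' s') \<C> ?P ?Q ?R"
      using tt K unfolding poristic_triangle_def C by blast
  qed (rule refl)+
  obtain A' B' C' where A': "A' = inversion O' r (midpoint B C)"
    and B': "B' = inversion O' r (midpoint C A)" and C': "C' = inversion O' r (midpoint A B)"
    and mout: "O' \<notin> {midpoint B C, midpoint C A, midpoint A B}"
    and por: "poristic_triangle (sphere N' s') \<C> A' B' C'"
    using touch [OF assms(1) S] assms(4) by blast
  have ne: "A \<noteq> B" "B \<noteq> C" "C \<noteq> A"
    using assms(1) by (auto simp: is_triangle_iff_det)
  have meet: "tangent_line \<C> Y \<inter> tangent_line \<C> Z = {inversion O' r (midpoint Y Z)}"
    if "Y \<in> sphere O' r" "Z \<in> sphere O' r" "Y \<noteq> Z" "midpoint Y Z \<noteq> O'" for Y Z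
    using pole_of_chord [OF r that(1-3)] that
    unfolding C tangent_line_sphere [OF r that(1)] tangent_line_sphere [OF r that(2)] by blast
  have E': "sphere N' s' = circumcircle A' B' C'"
    using por s' by (intro circumcircle_eqI [symmetric]) (auto simp: poristic_triangle_def)
  have "tangent_line \<C> B \<inter> tangent_line \<C> C = {A'}"
    "tangent_line \<C> A \<inter> tangent_line \<C> C = {B'}"
    "tangent_line \<C> A \<inter> tangent_line \<C> B = {C'}"
    using S ne mout meet [of B C] meet [of A C] meet [of A B]
    by (auto simp: A' B' C' midpoint_sym)
  moreover have "is_triangle A' B' C'"
    using por by (simp add: poristic_triangle_def)
  moreover have "poristic_pair (sphere N' s') \<C>"
    using por r s' C by (auto simp: poristic_pair_def is_circle_def)
  moreover have "circumcircle X Y Z = \<C> \<and> euler_circle X Y Z = \<E>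
      \<longleftrightarrow> in_touch_triangle (sphere N' s') \<C> X Y Z" if T: "is_triangle X Y Z" for X Y Z
  proof
    assume *: "circumcircle X Y Z = \<C> \<and> euler_circle X Y Z = \<E>"
    obtain M q where q: "q > 0" "{X, Y, Z} \<subseteq> sphere M q"
      using circumcentre_exists [OF T] .
    then have "{X, Y, Z} \<subseteq> sphere O' r"
      using circumcircle_eqI [OF T q] * C by simp
    then show "in_touch_triangle (sphere N' s') \<C> X Y Z"
      using touch [OF T] * unfolding in_touch_triangle_def by blast
  next
    assume "in_touch_triangle (sphere N' s') \<C> X Y Z"
    then obtain P Q R where PQR: "{P, Q, R} \<subseteq> sphere N' s'"
      and X: "X \<in> sphere O' r" "side_line Q R = polar O' r X"
      and Y: "Y \<in> sphere O' r" "side_line R P = polar O' r Y"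
      and Z: "Z \<in> sphere O' r" "side_line P Q = polar O' r Z"
      by (auto simp: in_touch_triangle_def poristic_triangle_def C tangent_at_sphere_iff [OF r])
    have ends: "V \<in> side_line V W" "W \<in> side_line V W" for V W
      by (simp_all add: side_line_def hull_inc)
    \<comment> \<open>Each vertex lies on two side lines, which are the tangents at two touch
      points. So it is the pole of a chord, and inverting back puts the midpoints on
      \<open>\<E>\<close>.\<close>
    have "P \<in> polar O' r Y \<inter> polar O' r Z" "Q \<in> polar O' r Z \<inter> polar O' r X"
      "R \<in> polar O' r X \<inter> polar O' r Y"
      unfolding X(2) [symmetric] Y(2) [symmetric] Z(2) [symmetric] by (simp_all add: ends)
    moreover have "X \<noteq> Y" "Y \<noteq> Z" "Z \<noteq> X"
      using T by (auto simp: is_triangle_iff_det)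
    ultimately have "P = inversion O' r (midpoint Y Z)" "Q = inversion O' r (midpoint Z X)"
      "R = inversion O' r (midpoint X Y)"
      using pole_of_chord [OF r Y(1) Z(1), of P] pole_of_chord [OF r Z(1) X(1), of Q]
        pole_of_chord [OF r X(1) Y(1), of R] by blast+
    then have "{midpoint Y Z, midpoint Z X, midpoint X Y} \<subseteq> sphere N s"
      using PQR by (simp only: insert_subset empty_subsetI inv')
    then have "euler_circle X Y Z = \<E>"
      unfolding euler_circle_def E by (rule circumcircle_eqI [OF midpoint_triangle [OF T] s])
    moreover have "circumcircle X Y Z = \<C>"
      unfolding C using X Y Z by (intro circumcircle_eqI [OF T r]) simp
    ultimately show "circumcircle X Y Z = \<C> \<and> euler_circle X Y Z = \<E>" by simp
  qed
  ultimately show ?thesis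
    using E' by metis
qed

end
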